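(* Let $(F_n)_{n=0}^\infty$ be a sequence of rational functions $F_n\in\mathbb C(X)$ and let $K\geqslant 1$ be an integer. Assume there exist infinitely many $\alpha\in\mathbb C$ such that every $F_n(\alpha)$, $n\geqslant 0$, is well defined and $(F_n(\alpha))_{n=0}^\infty$ is a linear recurrence sequence over $\mathbb C$ of order at most $K$. Then $(F_n)_{n=0}^\infty$ is a linear recurrence sequence over $\mathbb C(X)$ of order at most $K$.
   Context: A sequence $(u_n)_{n\geqslant 0}$ over a field $\mathbb F$ is a linear recurrence sequence of order $k$ if there are constants $A_0,\ldots,A_{k-1}\in\mathbb F$ such that $u_{n+k}=A_{k-1}u_{n+k-1}+\cdots+A_0u_n$ for all $n\geqslant 0$. *)

theory Defs
  imports Complex_Main "HOL-Computational_Algebra.Polynomial" "HOL-Computational_Algebra.Fraction_Field"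
begin

definition linear_recurrence_of_order :: "nat \<Rightarrow> (nat \<Rightarrow> 'a::field) \<Rightarrow> bool" where
  "linear_recurrence_of_order k u \<longleftrightarrow>
     (\<exists>A :: nat \<Rightarrow> 'a. \<forall>n. u (n + k) = (\<Sum>i<k. A i * u (n + i)))"

text \<open>The order \<open>k\<close> may be 0, which describes exactly the zero sequence; the zero sequence also
  has order 1 (with \<open>A 0 = 0\<close>), so for \<open>K \<ge> 1\<close> nothing changes if \<open>k \<ge> 1\<close> is required.\<close>

definition linear_recurrence_of_order_le :: "nat \<Rightarrow> (nat \<Rightarrow> 'a::field) \<Rightarrow> bool" where
  "linear_recurrence_of_order_le K u \<longleftrightarrow> (\<exists>k\<le>K. linear_recurrence_of_order k u)"

text \<open>The field \<open>\<complex>(X)\<close> is the type \<^typ>\<open>complex poly fract\<close>. A rational function is defined at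
  \<open>\<alpha>\<close> if it can be written as a quotient of polynomials whose denominator does not vanish at
  \<open>\<alpha>\<close>; its value there is the quotient of the values, which does not depend on the choice of
  such a representation (lemma \<open>rat_eval_Fract\<close>). Removable common zeros of a particular
  representation are thus not poles.\<close>

definition rat_defined_at :: "'a::field poly fract \<Rightarrow> 'a \<Rightarrow> bool" where
  "rat_defined_at F \<alpha> \<longleftrightarrow> (\<exists>p q. F = Fract p q \<and> poly q \<alpha> \<noteq> 0)"

definition rat_eval :: "'a::field poly fract \<Rightarrow> 'a \<Rightarrow> 'a" where
  "rat_eval F \<alpha> = (THE v. \<exists>p q. F = Fract p q \<and> poly q \<alpha> \<noteq> 0 \<and> v = poly p \<alpha> / poly q \<alpha>)"

lemma rat_eval_Fract:
  fixes p q :: "'a::field poly"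
  assumes "poly q \<alpha> \<noteq> 0"
  shows "rat_eval (Fract p q) \<alpha> = poly p \<alpha> / poly q \<alpha>"
  unfolding rat_eval_def
proof (rule the_equality)
  show "\<exists>p' q'. Fract p q = Fract p' q' \<and> poly q' \<alpha> \<noteq> 0 \<and> poly p \<alpha> / poly q \<alpha> = poly p' \<alpha> / poly q' \<alpha>"
    using assms by blast
next
  fix v
  assume "\<exists>p' q'. Fract p q = Fract p' q' \<and> poly q' \<alpha> \<noteq> 0 \<and> v = poly p' \<alpha> / poly q' \<alpha>"
  then obtain p' q' where *: "Fract p q = Fract p' q'" "poly q' \<alpha> \<noteq> 0" "v = poly p' \<alpha> / poly q' \<alpha>"
    by blast
  have "q \<noteq> 0" "q' \<noteq> 0"
    using assms *(2) by auto
  with *(1) have "p * q' = p' * q"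
    by (simp add: eq_fract)
  then have "poly p \<alpha> * poly q' \<alpha> = poly p' \<alpha> * poly q \<alpha>"
    by (metis poly_mult)
  then show "v = poly p \<alpha> / poly q \<alpha>"
    using assms *(2,3) by (simp add: frac_eq_eq)
qed

end

(*
  A sequence u is a linear recurrence sequence of order at most K iff some nonzero vector c of
  length K+1 annihilates all windows (u n, ..., u (n+K)).  If no nonzero vector over C(X)
  annihilates the windows of F, then the windows span, so each unit vector is a finite C(X)-linear
  combination of windows.  Only finitely many points are poles of the coefficients involved; at
  any other point where all F n are defined, the combinations specialise and show that no nonzero
  complex vector annihilates the specialised windows.
*)
theory Submission imports Defs begin

text \<open>Replaces a recurrence of varying order with leading coefficient 1 by a linear condition
  of fixed length \<open>Suc K\<close>. A recurrence yields \<open>c\<close> by padding with zeros;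
  conversely one solves for the term at the last nonzero entry of \<open>c\<close>.\<close>

lemma linear_recurrence_of_order_le_iff_annihilator:
  "linear_recurrence_of_order_le K u \<longleftrightarrow>
     (\<exists>c. (\<exists>i<Suc K. c i \<noteq> 0) \<and> (\<forall>n. (\<Sum>i<Suc K. c i * u (n + i)) = 0))"
proof
  assume "linear_recurrence_of_order_le K u"
  then obtain k A where k: "k \<le> K" and A: "\<And>n. u (n + k) = (\<Sum>i<k. A i * u (n + i))"
    by (auto simp: linear_recurrence_of_order_le_def linear_recurrence_of_order_def)
  define c where "c i = (if i < k then A i else if i = k then -1 else 0)" for i
  have "(\<Sum>i<Suc K. c i * u (n + i)) = 0" for n
  proof -
    have "(\<Sum>i<Suc K. c i * u (n + i)) = (\<Sum>i<Suc k. c i * u (n + i))"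
      by (rule sum.mono_neutral_right) (use k in \<open>auto simp: c_def\<close>)
    also have "\<dots> = (\<Sum>i<k. A i * u (n + i)) - u (n + k)"
      by (simp add: c_def)
    finally show ?thesis by (simp add: A)
  qed
  moreover have "c k \<noteq> 0" "k < Suc K" using k by (auto simp: c_def)
  ultimately show "\<exists>c. (\<exists>i<Suc K. c i \<noteq> 0) \<and> (\<forall>n. (\<Sum>i<Suc K. c i * u (n + i)) = 0)"
    by blast
next
  assume "\<exists>c. (\<exists>i<Suc K. c i \<noteq> 0) \<and> (\<forall>n. (\<Sum>i<Suc K. c i * u (n + i)) = 0)"
  then obtain c where c: "\<exists>i<Suc K. c i \<noteq> 0" and ann: "\<And>n. (\<Sum>i<Suc K. c i * u (n + i)) = 0"
    by blast
  \<comment> \<open>The order is the largest index \<open>k\<close> with \<open>c k\<close> nonzero: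
    later terms drop out and \<open>c k\<close> can be divided by. If \<open>k = 0\<close>, then
    \<open>u\<close> is zero, which is a recurrence of order 0.\<close>
  define I where "I = {i. i < Suc K \<and> c i \<noteq> 0}"
  define k where "k = Max I"
  have I: "finite I" "I \<noteq> {}" using c by (auto simp: I_def)
  have "k \<in> I" unfolding k_def using I by (rule Max_in)
  then have k: "k \<le> K" "c k \<noteq> 0" by (auto simp: I_def)
  have zero: "c i = 0" if "k < i" "i < Suc K" for i
  proof (rule ccontr)
    assume "c i \<noteq> 0"
    with that have "i \<in> I" by (simp add: I_def)
    then have "i \<le> k" unfolding k_def using I(1) by (simp add: Max_ge)
    with that show False by simp
  qed
  have "u (n + k) = (\<Sum>i<k. - c i / c k * u (n + i))" for n
  proof -
    have "0 = (\<Sum>i<Suc k. c i * u (n + i))"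
      unfolding ann[of n, symmetric]
      by (rule sum.mono_neutral_right) (use k zero in auto)
    then have "c k * u (n + k) = - (\<Sum>i<k. c i * u (n + i))"
      by (simp add: eq_neg_iff_add_eq_0 add.commute)
    then have "u (n + k) = - (\<Sum>i<k. c i * u (n + i)) / c k"
      using k by (simp add: field_simps)
    then show ?thesis
      by (simp add: sum_divide_distrib sum_negf)
  qed
  then have "linear_recurrence_of_order k u"
    by (auto simp: linear_recurrence_of_order_def intro!: exI[of _ "\<lambda>i. - c i / c k"])
  with k show "linear_recurrence_of_order_le K u"
    by (auto simp: linear_recurrence_of_order_le_def)
qed

text \<open>Duality in dimension \<open>m\<close>: a proper subspace lies in the kernel of a nonzero
  functional. Vectors are functions on all of \<open>nat\<close>, but only the coordinates below
  \<open>m\<close> are controlled, so the induction on \<open>m\<close> can keep the same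
  \<open>V\<close>.\<close>

lemma subspace_annihilator_or_unit_vectors:
  fixes V :: "(nat \<Rightarrow> 'a::field) set"
  assumes zero: "(\<lambda>_. 0) \<in> V"
    and add: "\<And>v w. v \<in> V \<Longrightarrow> w \<in> V \<Longrightarrow> (\<lambda>i. v i + w i) \<in> V"
    and scale: "\<And>a v. v \<in> V \<Longrightarrow> (\<lambda>i. a * v i) \<in> V"
  shows "(\<exists>c. (\<exists>i<m. c i \<noteq> 0) \<and> (\<forall>v\<in>V. (\<Sum>i<m. c i * v i) = 0)) \<or>
         (\<forall>j<m. \<exists>v\<in>V. \<forall>i<m. v i = (if i = j then 1 else 0))"
proof (induction m)
  case (Suc m)
  have sum_closed: "(\<lambda>i. \<Sum>j\<in>J. f j i) \<in> V" if "finite J" "\<And>j. j \<in> J \<Longrightarrow> f j \<in> V" for J :: "nat set" and f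
    using that by (induction J rule: finite_induct) (auto intro: zero add)
  from Suc show ?case
  proof
    assume "\<exists>c. (\<exists>i<m. c i \<noteq> 0) \<and> (\<forall>v\<in>V. (\<Sum>i<m. c i * v i) = 0)"
    then obtain c where c: "\<exists>i<m. c i \<noteq> 0" "\<forall>v\<in>V. (\<Sum>i<m. c i * v i) = 0" by blast
    have "\<exists>i<Suc m. (c(m := 0)) i \<noteq> 0" using c(1) by (auto intro: less_SucI)
    moreover have "\<forall>v\<in>V. (\<Sum>i<Suc m. (c(m := 0)) i * v i) = 0" using c(2) by simp
    ultimately show ?thesis by blast
  next
    assume "\<forall>j<m. \<exists>v\<in>V. \<forall>i<m. v i = (if i = j then 1 else 0)"
    then obtain e where eV: "\<And>j. j < m \<Longrightarrow> e j \<in> V"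
      and e: "\<And>i j. j < m \<Longrightarrow> i < m \<Longrightarrow> e j i = (if i = j then 1 else 0)"
      by metis
    \<comment> \<open>This functional vanishes on \<open>V\<close> exactly if coordinate
      \<open>m\<close> of each \<open>v\<close> is the one predicted from its earlier coordinates by
      the vectors \<open>e j\<close>.\<close>
    define c where "c i = (if i < m then e i m else -1)" for i
    show ?thesis
    proof (cases "\<forall>v\<in>V. (\<Sum>i<Suc m. c i * v i) = 0")
      case True
      moreover have "\<exists>i<Suc m. c i \<noteq> 0" by (auto simp: c_def)
      ultimately show ?thesis by blast
    next
      case False
      then obtain v where v: "v \<in> V" and "(\<Sum>i<Suc m. c i * v i) \<noteq> 0" by blast
      \<comment> \<open>Subtracting the combination of the \<open>e j\<close> that agrees with
        \<open>v\<close> below \<open>m\<close> leaves only coordinate \<open>m\<close>, which is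
        minus the value of the functional at \<open>v\<close>, hence nonzero.\<close>
      define w where "w i = v i + (-1) * (\<Sum>j<m. v j * e j i)" for i
      have wV: "w \<in> V"
        unfolding w_def by (intro add v scale sum_closed) (auto intro: eV)
      have w0: "w i = 0" if "i < m" for i
      proof -
        have "(\<Sum>j<m. v j * e j i) = (\<Sum>j<m. if i = j then v j else 0)"
          using that by (intro sum.cong) (auto simp: e)
        then show ?thesis using that by (simp add: w_def)
      qed
      have "w m \<noteq> 0"
        using \<open>(\<Sum>i<Suc m. c i * v i) \<noteq> 0\<close> by (simp add: w_def c_def mult.commute)
      define x where "x i = inverse (w m) * w i" for i
      have xV: "x \<in> V" unfolding x_def by (intro scale wV)
      have x: "x m = 1" "\<And>i. i < m \<Longrightarrow> x i = 0"
        using \<open>w m \<noteq> 0\<close> w0 by (auto simp: x_def)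
      have "\<exists>v\<in>V. \<forall>i<Suc m. v i = (if i = j then 1 else 0)" if "j < Suc m" for j
      proof (cases "j = m")
        case True
        with xV x show ?thesis by (auto simp: less_Suc_eq intro!: bexI[of _ x])
      next
        case False
        with that have j: "j < m" by simp
        \<comment> \<open>The old \<open>e j\<close> may have any entry at \<open>m\<close>; a
          multiple of \<open>x\<close> clears it without disturbing the coordinates below
          \<open>m\<close>.\<close>
        have "(\<lambda>i. e j i + (- e j m) * x i) \<in> V" by (intro add scale eV xV j)
        moreover have "\<forall>i<Suc m. e j i + (- e j m) * x i = (if i = j then 1 else 0)"
          using j by (auto simp: less_Suc_eq e x)
        ultimately show ?thesis by (intro bexI[where x = "\<lambda>i. e j i + (- e j m) * x i"]) simp_all
      qed
      then show ?thesis by blast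
    qed
  qed
qed simp

lemma rat_defined_at_Fract: "poly q \<alpha> \<noteq> 0 \<Longrightarrow> rat_defined_at (Fract p q) \<alpha>"
  by (auto simp: rat_defined_at_def)

lemma
  assumes "rat_defined_at F \<alpha>" "rat_defined_at G \<alpha>"
  shows rat_defined_at_add: "rat_defined_at (F + G) \<alpha>"
    and rat_eval_add: "rat_eval (F + G) \<alpha> = rat_eval F \<alpha> + rat_eval G \<alpha>"
    and rat_defined_at_mult: "rat_defined_at (F * G) \<alpha>"
    and rat_eval_mult: "rat_eval (F * G) \<alpha> = rat_eval F \<alpha> * rat_eval G \<alpha>"
proof -
  obtain p q r s where F: "F = Fract p q" "poly q \<alpha> \<noteq> 0" and G: "G = Fract r s" "poly s \<alpha> \<noteq> 0"
    using assms by (auto simp: rat_defined_at_def)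
  have add: "F + G = Fract (p * s + r * q) (q * s)"
    using F G by (metis add_fract poly_0)
  have mult: "F * G = Fract (p * r) (q * s)" using F G by simp
  show "rat_defined_at (F + G) \<alpha>" "rat_defined_at (F * G) \<alpha>"
    unfolding add mult using F G by (auto intro!: rat_defined_at_Fract)
  show "rat_eval (F + G) \<alpha> = rat_eval F \<alpha> + rat_eval G \<alpha>"
    "rat_eval (F * G) \<alpha> = rat_eval F \<alpha> * rat_eval G \<alpha>"
    unfolding add mult using F G by (simp_all add: rat_eval_Fract add_frac_eq)
qed

lemma
  shows rat_defined_at_0: "rat_defined_at 0 \<alpha>" and rat_eval_0: "rat_eval 0 \<alpha> = 0"
    and rat_eval_1: "rat_eval 1 \<alpha> = 1"
  by (simp_all add: Zero_fract_def One_fract_def rat_defined_at_Fract rat_eval_Fract)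

text \<open>All poles are among the finitely many roots of the denominator of any one
  representation.\<close>

lemma finite_poles: "finite {\<alpha>. \<not> rat_defined_at F \<alpha>}"
proof (cases F)
  case (Fract p q)
  have "{\<alpha>. \<not> rat_defined_at F \<alpha>} \<subseteq> {\<alpha>. poly q \<alpha> = 0}"
    using Fract by (auto intro: rat_defined_at_Fract)
  with Fract show ?thesis using poly_roots_finite finite_subset by blast
qed

theorem theorem2p12:
  fixes F :: "nat \<Rightarrow> complex poly fract" and K :: nat
  assumes "K \<ge> 1"
    and "infinite {\<alpha> :: complex. (\<forall>n. rat_defined_at (F n) \<alpha>) \<and>
           linear_recurrence_of_order_le K (\<lambda>n. rat_eval (F n) \<alpha>)}"
  shows "linear_recurrence_of_order_le K F"
proof (rule ccontr)
  assume no_rec: "\<not> linear_recurrence_of_order_le K F"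
  define S where "S = {\<alpha>. (\<forall>n. rat_defined_at (F n) \<alpha>) \<and>
    linear_recurrence_of_order_le K (\<lambda>n. rat_eval (F n) \<alpha>)}"
  \<comment> \<open>\<open>P v \<alpha>\<close> says dually that \<open>v\<close> specialises at
    \<alpha> into the complex span of the specialised windows: whatever annihilates them all
    annihilates the value of \<open>v\<close>.\<close>
  define P where "P v \<alpha> \<longleftrightarrow> (\<forall>i<Suc K. rat_defined_at (v i) \<alpha>) \<and>
      (\<forall>c. (\<forall>n. (\<Sum>i<Suc K. c i * rat_eval (F (n + i)) \<alpha>) = 0) \<longrightarrow>
           (\<Sum>i<Suc K. c i * rat_eval (v i) \<alpha>) = 0)" for v :: "nat \<Rightarrow> complex poly fract" and \<alpha>
  \<comment> \<open>Contains the span of the windows of \<open>F\<close>, but is closed under linear combinations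
    without having to track coefficients.\<close>
  define V where "V = {v. finite {\<alpha>\<in>S. \<not> P v \<alpha>}}"
  have window: "(\<lambda>i. F (n + i)) \<in> V" for n
  proof -
    have "{\<alpha>\<in>S. \<not> P (\<lambda>i. F (n + i)) \<alpha>} = {}" by (auto simp: P_def S_def)
    then show ?thesis by (simp only: V_def mem_Collect_eq finite.emptyI)
  qed
  have "(\<lambda>_. 0) \<in> V"
    by (simp add: V_def P_def rat_defined_at_0 rat_eval_0)
  moreover have "(\<lambda>i. v i + w i) \<in> V" if "v \<in> V" "w \<in> V" for v w
  proof -
    have "P (\<lambda>i. v i + w i) \<alpha>" if "P v \<alpha>" "P w \<alpha>" for \<alpha>
    proof -
      have "(\<Sum>i<Suc K. c i * rat_eval (v i + w i) \<alpha>) =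
          (\<Sum>i<Suc K. c i * rat_eval (v i) \<alpha>) + (\<Sum>i<Suc K. c i * rat_eval (w i) \<alpha>)" for c
        unfolding sum.distrib[symmetric] using that
        by (intro sum.cong) (auto simp: P_def rat_eval_add algebra_simps)
      with that show ?thesis unfolding P_def by (auto intro: rat_defined_at_add)
    qed
    then have "{\<alpha>\<in>S. \<not> P (\<lambda>i. v i + w i) \<alpha>} \<subseteq> {\<alpha>\<in>S. \<not> P v \<alpha>} \<union> {\<alpha>\<in>S. \<not> P w \<alpha>}" by blast
    with that show ?thesis unfolding V_def using finite_subset by blast
  qed
  moreover have "(\<lambda>i. a * v i) \<in> V" if "v \<in> V" for a v
  proof -
    have "P (\<lambda>i. a * v i) \<alpha>" if "P v \<alpha>" "rat_defined_at a \<alpha>" for \<alpha>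
    proof -
      have "(\<Sum>i<Suc K. c i * rat_eval (a * v i) \<alpha>) =
          rat_eval a \<alpha> * (\<Sum>i<Suc K. c i * rat_eval (v i) \<alpha>)" for c
        unfolding sum_distrib_left using that
        by (intro sum.cong) (auto simp: P_def rat_eval_mult)
      with that show ?thesis unfolding P_def by (auto intro: rat_defined_at_mult)
    qed
    \<comment> \<open>Scaling by a rational function creates new exceptional points only at its
      poles. This is why \<open>V\<close> allows finitely many exceptions.\<close>
    then have "{\<alpha>\<in>S. \<not> P (\<lambda>i. a * v i) \<alpha>} \<subseteq> {\<alpha>\<in>S. \<not> P v \<alpha>} \<union> {\<alpha>. \<not> rat_defined_at a \<alpha>}" by blast
    with that show ?thesis unfolding V_def using finite_subset finite_poles by blast
  qed
  ultimately have "(\<exists>c. (\<exists>i<Suc K. c i \<noteq> 0) \<and> (\<forall>v\<in>V. (\<Sum>i<Suc K. c i * v i) = 0)) \<or>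
      (\<forall>j<Suc K. \<exists>v\<in>V. \<forall>i<Suc K. v i = (if i = j then 1 else 0))"
    by (rule subspace_annihilator_or_unit_vectors)
  \<comment> \<open>Such a \<open>c\<close> would annihilate the windows of \<open>F\<close> in
    particular, and so give the recurrence over the rational functions that was excluded.\<close>
  moreover have "\<not> (\<exists>c. (\<exists>i<Suc K. c i \<noteq> 0) \<and> (\<forall>v\<in>V. (\<Sum>i<Suc K. c i * v i) = 0))"
  proof
    assume "\<exists>c. (\<exists>i<Suc K. c i \<noteq> 0) \<and> (\<forall>v\<in>V. (\<Sum>i<Suc K. c i * v i) = 0)"
    then obtain c where "\<exists>i<Suc K. c i \<noteq> 0" and c: "\<forall>v\<in>V. (\<Sum>i<Suc K. c i * v i) = 0"
      by blast
    moreover have "(\<Sum>i<Suc K. c i * F (n + i)) = 0" for n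
      using c[rule_format, OF window[of n]] .
    ultimately show False
      using no_rec unfolding linear_recurrence_of_order_le_iff_annihilator by blast
  qed
  ultimately have "\<forall>j<Suc K. \<exists>v\<in>V. \<forall>i<Suc K. v i = (if i = j then 1 else 0)"
    by blast
  then obtain e where eV: "\<And>j. j < Suc K \<Longrightarrow> e j \<in> V"
    and e: "\<And>i j. j < Suc K \<Longrightarrow> i < Suc K \<Longrightarrow> e j i = (if i = j then 1 else 0)"
    by metis
  \<comment> \<open>Finitely many vectors \<open>e j\<close> have finitely many exceptional points
    in total, so the infinite set \<open>S\<close> contains a point that is good for all of
    them.\<close>
  have "finite (\<Union>j<Suc K. {\<alpha>\<in>S. \<not> P (e j) \<alpha>})"
    using eV by (auto simp: V_def)
  moreover have "infinite S" using assms(2) by (simp add: S_def)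
  ultimately have "\<not> S \<subseteq> (\<Union>j<Suc K. {\<alpha>\<in>S. \<not> P (e j) \<alpha>})"
    using finite_subset by blast
  then obtain \<alpha> where \<alpha>: "\<alpha> \<in> S" and Pe: "\<And>j. j < Suc K \<Longrightarrow> P (e j) \<alpha>" by blast
  from \<alpha> obtain c j where j: "j < Suc K" "c j \<noteq> 0"
    and c: "\<forall>n. (\<Sum>i<Suc K. c i * rat_eval (F (n + i)) \<alpha>) = 0"
    by (auto simp: S_def linear_recurrence_of_order_le_iff_annihilator)
  \<comment> \<open>The index \<open>j\<close> was chosen with \<open>c j\<close> nonzero. Since
    \<open>e j\<close> specialises to the unit vector at \<open>j\<close>, this sum is also
    \<open>c j\<close>, a contradiction.\<close>
  have "(\<Sum>i<Suc K. c i * rat_eval (e j i) \<alpha>) = 0"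
    using Pe[OF j(1)] c by (auto simp: P_def)
  moreover have "(\<Sum>i<Suc K. c i * rat_eval (e j i) \<alpha>) = (\<Sum>i<Suc K. if i = j then c i else 0)"
    using j(1) by (intro sum.cong) (auto simp: e rat_eval_0 rat_eval_1)
  ultimately show False using j by (auto split: if_splits)
qed

end
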